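(* At every iteration before termination, Algorithm iBDCA (described in the context) is well defined. More precisely: (i) the convex subproblem defining $y^k$ has a unique solution; (ii) $\Phi_\rho(y^k)\le\Phi_\rho(w^k)-(\lambda_2+\nu)\|d^k\|^2$; (iii) if the algorithm reaches the line-search step, then $\lambda_k^{\max}$ exists, satisfies $\lambda_k^{\max}\ge1$, and the backtracking loop terminates after finitely many reductions with $1\le\lambda_k\le\min\{\bar\lambda,\lambda_k^{\max}\}$. Consequently, $x^{k+1}\in\mathcal X$.
   Context: Model. Let $n,T\in\mathbb N=\{1,2,\dots\}$. Let $X:=\{z\in\mathbb R^n:\sum_{i=1}^n z_i=1,\ z_i\ge 0,\ i=1,\dots,n\}$ and $\mathcal X:=X^T\subset(\mathbb R^n)^T\cong\mathbb R^{nT}$; elements are written $x=(x^1,\dots,x^T)$ with blocks $x^t\in\mathbb R^n$, and $\|\cdot\|$ is the Euclidean norm. Fix $w_{\mathrm{prev}}\in X$. For each $t=1,\dots,T$ let $S_t\in\mathbb N$ and let $\xi^t$ be a discrete random vector taking values $\xi^t_j\in\mathbb R^n$ with probabilities $p^t_j>0$, $j=1,\dots,S_t$, $\sum_{j=1}^{S_t}p^t_j=1$; put $\mu^t:=\sum_{j=1}^{S_t}p_j^t\xi_j^t$ and $L_j^t(z):=-(\xi_j^t)^\top z$. Fix $\alpha\in(0,1)$, $\lambda_1>0$, $\lambda_2>0$, $c_i\ge 0$ ($i=1,\dots,n$), and $\tau\in\mathbb R$. Let $(a)_+:=\max\{a,0\}$. For a real random variable $L$, $\operatorname{VaR}_\alpha(L):=\inf\{u\in\mathbb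 R:\mathbb P(L\le u)\ge\alpha\}$. $f(x):=-\sum_{t=1}^T(\mu^t)^\top x^t+\lambda_1\Big[\sum_{i=1}^n c_i|x_i^1-(w_{\mathrm{prev}})_i|+\sum_{t=2}^T\sum_{i=1}^n c_i|x_i^t-x_i^{t-1}|\Big]+\lambda_2\sum_{t=1}^T\|x^t\|^2$; $R(x):=\sum_{t=1}^T\big(\operatorname{VaR}_\alpha(-(\xi^t)^\top x^t)-\tau\big)_+$; for $\rho>0$, $\Phi_\rho:=f+\rho R$. DC decomposition. For $\beta\in(0,1)$ let $\psi_{\beta,t}(z):=\min_{u\in\mathbb R}\{u+\frac1{1-\beta}\sum_{j=1}^{S_t}p_j^t(L_j^t(z)-u)_+\}$ (the CVaR at level $\beta$ of $-(\xi^t)^\top z$). Let $\bar\varepsilon_t:=\alpha-\max\{\sum_{j\in J}p_j^t: J\subseteq\{1,\dots,S_t\},\ \sum_{j\in J}p_j^t<\alpha\}$ (empty sum $=0$), fix $0<\gamma<\min_t\bar\varepsilon_t$, and set $A_\gamma:=\frac{1-\alpha+\gamma}{\gamma}$, $B_\gamma:=\frac{1-\alpha}{\gamma}$. Then $\operatorname{VaR}_\alpha(-(\xi^t)^\top z)=A_\gamma\psi_{\alpha-\gamma,t}(z)-B_\gamma\psi_{\alpha,t}(z)$ and $\Phi_\rho=G_\rho-H_\rho$ with $G_\rho(x):=f(x)+\rho\sum_{t=1}^T\max\{A_\gamma\psi_{\alpha-\gamma,t}(x^t)-\tau,\ B_\gamma\psi_{\alpha,t}(x^t)\}$, $H_\rho(x):=\rho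 B_\gamma\sum_{t=1}^T\psi_{\alpha,t}(x^t)$. For fixed $\nu>0$: $\widehat G_\rho:=G_\rho+\frac\nu2\|\cdot\|^2$, $\widehat H_\rho:=H_\rho+\frac\nu2\|\cdot\|^2$. For convex functions $\partial$ is the convex subdifferential. Algorithm iBDCA. Input: $\rho>0$, $x^{-1}=x^0\in\mathcal X$, $\theta\in[0,1)$, $\nu>0$, $\sigma\in(0,\lambda_2+\nu)$, $\eta\in(0,1)$, $\bar\lambda>1$, $\varepsilon_{\mathrm{tol}}\ge0$. Here superscript $k$ indexes iterates in $\mathcal X$ and $w^{k,t}$ is the $t$-th block of $w^k$; $\Pi_{\mathcal X}$ is Euclidean projection onto $\mathcal X$. For $k=0,1,2,\dots$: 1. $w^k=\Pi_{\mathcal X}(x^k+\theta(x^k-x^{k-1}))$; if $\Phi_\rho(w^k)>\Phi_\rho(x^k)$, reset $w^k=x^k$. 2. For each $t$ compute $g_{\alpha,t}(w^{k,t})=-\frac{1}{1-\alpha}\sum_{j}p_j^t\vartheta_j\xi_j^t\in\partial\psi_{\alpha,t}(w^{k,t})$, where, for a minimizer $u^*$ in the definition of $\psi_{\alpha,t}(w^{k,t})$, $\vartheta_j=1$ if $L_j^t(w^{k,t})>u^*$, $\vartheta_j\in[0,1]$ if $L_j^t(w^{k,t})=u^*$, $\vartheta_j=0$ if $L_j^t(w^{k,t})<u^*$, and $\sum_jp_j^t\vartheta_j=1-\alpha$. Set $s^k=\rho B_\gamma(g_{\alpha,1}(w^{k,1}),\dots,g_{\alpha,T}(w^{k,T}))\in\partial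 H_\rho(w^k)$ and $u^k=s^k+\nu w^k\in\partial\widehat H_\rho(w^k)$. 3. $y^k=\operatorname*{arg\,min}_{x\in\mathcal X}\{\widehat G_\rho(x)-\langle u^k,x\rangle\}$; $d^k=y^k-w^k$. 4. If $\|d^k\|=0$, return $w^k$. If $\varepsilon_{\mathrm{tol}}>0$ and $\|d^k\|\le\varepsilon_{\mathrm{tol}}\max\{1,\|w^k\|\}$, return $w^k$. 5. (Line search) $\lambda_k^{\max}=\max\{\lambda\ge1:w^k+\lambda d^k\in\mathcal X\}$; $\lambda_k=\min\{\bar\lambda,\lambda_k^{\max}\}$. While $\lambda_k>1$ and $\Phi_\rho(w^k+\lambda_kd^k)>\min\{\Phi_\rho(y^k),\ \Phi_\rho(w^k)-\sigma\lambda_k^2\|d^k\|^2\}$, set $\lambda_k=\max\{1,\eta\lambda_k\}$. 6. $x^{k+1}=w^k+\lambda_kd^k$. *)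

theory Defs
  imports "HOL-Probability.Probability" "HOL-Library.While_Combinator"
begin

text \<open>
  The space of one portfolio is \<open>real ^ 'n\<close>, the space of a portfolio sequence is
  \<open>real ^ 'n ^ 't\<close>, whose norm is the Euclidean norm of the concatenated blocks. The periods
  \<open>1, \<dots>, T\<close> are the elements of a finite linear order \<open>'t\<close>, so that \<open>T = CARD('t)\<close>.
\<close>

type_synonym ('t, 'n) plan = "real ^ 'n ^ 't"

definition first_period :: "'t::{finite,linorder}" where
  "first_period = Min UNIV"

text \<open>Only meaningful for \<open>t \<noteq> first_period\<close>.\<close>

definition prev_period :: "'t::{finite,linorder} \<Rightarrow> 't" where
  "prev_period t = Max {s. s < t}"

definition portfolios :: "(real ^ 'n) set" where
  "portfolios = {z. (\<Sum>i\<in>UNIV. z $ i) = 1 \<and> (\<forall>i. 0 \<le> z $ i)}"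

definition feasible :: "('t::finite, 'n::finite) plan set" where
  "feasible = {x. \<forall>t. x $ t \<in> portfolios}"

definition VaR :: "'w measure \<Rightarrow> real \<Rightarrow> ('w \<Rightarrow> real) \<Rightarrow> real" where
  "VaR M a L = Inf {u. a \<le> measure M {\<omega> \<in> space M. L \<omega> \<le> u}}"


section \<open>The model\<close>

text \<open>
  \<open>xi t\<close> is the random vector of period \<open>t\<close>; its scenarios \<open>scen t j\<close>, of probability \<open>pr t j\<close>, are
  indexed by \<open>j \<in> {1..nscen t}\<close>.
\<close>

record ('w, 't, 'n) model =
  pspace :: "'w measure"
  xi :: "'t \<Rightarrow> 'w \<Rightarrow> real ^ 'n"
  nscen :: "'t \<Rightarrow> nat"
  scen :: "'t \<Rightarrow> nat \<Rightarrow> real ^ 'n"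
  pr :: "'t \<Rightarrow> nat \<Rightarrow> real"
  w_prev :: "real ^ 'n"
  alpha :: real
  lambda1 :: real
  lambda2 :: real
  cost :: "'n \<Rightarrow> real"
  tau :: real
  gam :: real

definition eps_bar :: "('w, 't, 'n::finite) model \<Rightarrow> 't \<Rightarrow> real" where
  "eps_bar P t = alpha P -
     Max ((\<lambda>J. \<Sum>j\<in>J. pr P t j) ` {J. J \<subseteq> {1..nscen P t} \<and> (\<Sum>j\<in>J. pr P t j) < alpha P})"

text \<open>
  Scenario values need not be distinct, so the probability that \<open>xi t\<close> equals a given scenario is the
  total weight of all scenarios with that value.
\<close>

definition valid_model :: "('w, 't::{finite,linorder}, 'n::finite) model \<Rightarrow> bool" where
  "valid_model P \<longleftrightarrow>
     prob_space (pspace P) \<and>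
     (\<forall>t. xi P t \<in> borel_measurable (pspace P)) \<and>
     (\<forall>t. 1 \<le> nscen P t) \<and>
     (\<forall>t. \<forall>j\<in>{1..nscen P t}. 0 < pr P t j) \<and>
     (\<forall>t. (\<Sum>j = 1..nscen P t. pr P t j) = 1) \<and>
     (\<forall>t. \<forall>j\<in>{1..nscen P t}.
        measure (pspace P) {\<omega> \<in> space (pspace P). xi P t \<omega> = scen P t j} =
        (\<Sum>i | i \<in> {1..nscen P t} \<and> scen P t i = scen P t j. pr P t i)) \<and>
     w_prev P \<in> portfolios \<and>
     0 < alpha P \<and> alpha P < 1 \<and>
     0 < lambda1 P \<and> 0 < lambda2 P \<and>
     (\<forall>i. 0 \<le> cost P i) \<and>
     0 < gam P \<and> gam P < Min (range (eps_bar P))"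

definition mean :: "('w, 't, 'n::finite) model \<Rightarrow> 't \<Rightarrow> real ^ 'n" where
  "mean P t = (\<Sum>j = 1..nscen P t. pr P t j *\<^sub>R scen P t j)"

definition loss :: "('w, 't, 'n::finite) model \<Rightarrow> 't \<Rightarrow> nat \<Rightarrow> real ^ 'n \<Rightarrow> real" where
  "loss P t j z = - (scen P t j \<bullet> z)"

definition obj :: "('w, 't::{finite,linorder}, 'n::finite) model \<Rightarrow> ('t, 'n) plan \<Rightarrow> real" where
  "obj P x =
     - (\<Sum>t\<in>UNIV. mean P t \<bullet> x $ t)
     + lambda1 P *
         ((\<Sum>i\<in>UNIV. cost P i * \<bar>x $ first_period $ i - w_prev P $ i\<bar>)
          + (\<Sum>t\<in>UNIV - {first_period}. \<Sum>i\<in>UNIV.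
               cost P i * \<bar>x $ t $ i - x $ prev_period t $ i\<bar>))
     + lambda2 P * (\<Sum>t\<in>UNIV. (norm (x $ t))\<^sup>2)"

definition risk :: "('w, 't::{finite,linorder}, 'n::finite) model \<Rightarrow> ('t, 'n) plan \<Rightarrow> real" where
  "risk P x =
     (\<Sum>t\<in>UNIV. max (VaR (pspace P) (alpha P) (\<lambda>\<omega>. - (xi P t \<omega> \<bullet> x $ t)) - tau P) 0)"

definition Phi ::
    "('w, 't::{finite,linorder}, 'n::finite) model \<Rightarrow> real \<Rightarrow> ('t, 'n) plan \<Rightarrow> real" where
  "Phi P \<rho> x = obj P x + \<rho> * risk P x"


section \<open>The DC decomposition\<close>

definition cvar_fun ::
    "('w, 't, 'n::finite) model \<Rightarrow> real \<Rightarrow> 't \<Rightarrow> real ^ 'n \<Rightarrow> real \<Rightarrow> real" where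
  "cvar_fun P \<beta> t z u =
     u + 1 / (1 - \<beta>) * (\<Sum>j = 1..nscen P t. pr P t j * max (loss P t j z - u) 0)"

text \<open>For \<open>\<beta>\<close> in \<open>(0, 1)\<close> the infimum is attained, so it is the minimum.\<close>

definition psi :: "('w, 't, 'n::finite) model \<Rightarrow> real \<Rightarrow> 't \<Rightarrow> real ^ 'n \<Rightarrow> real" where
  "psi P \<beta> t z = (INF u. cvar_fun P \<beta> t z u)"

definition A_gam :: "('w, 't, 'n::finite) model \<Rightarrow> real" where
  "A_gam P = (1 - alpha P + gam P) / gam P"

definition B_gam :: "('w, 't, 'n::finite) model \<Rightarrow> real" where
  "B_gam P = (1 - alpha P) / gam P"

definition G_fun ::
    "('w, 't::{finite,linorder}, 'n::finite) model \<Rightarrow> real \<Rightarrow> ('t, 'n) plan \<Rightarrow> real" where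
  "G_fun P \<rho> x =
     obj P x + \<rho> * (\<Sum>t\<in>UNIV.
       max (A_gam P * psi P (alpha P - gam P) t (x $ t) - tau P)
           (B_gam P * psi P (alpha P) t (x $ t)))"

definition G_hat ::
    "('w, 't::{finite,linorder}, 'n::finite) model \<Rightarrow> real \<Rightarrow> real \<Rightarrow> ('t, 'n) plan \<Rightarrow> real" where
  "G_hat P \<rho> \<nu> x = G_fun P \<rho> x + \<nu> / 2 * (norm x)\<^sup>2"


section \<open>The algorithm\<close>

record ('t, 'n) params =
  rho :: real
  x_init :: "('t, 'n) plan"
  theta :: real
  nu :: real
  sigma :: real
  eta :: real
  lambda_bar :: real
  eps_tol :: real

definition valid_params ::
    "('w, 't::{finite,linorder}, 'n::finite) model \<Rightarrow> ('t, 'n) params \<Rightarrow> bool" where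
  "valid_params P A \<longleftrightarrow>
     0 < rho A \<and> x_init A \<in> feasible \<and>
     0 \<le> theta A \<and> theta A < 1 \<and>
     0 < nu A \<and>
     0 < sigma A \<and> sigma A < lambda2 P + nu A \<and>
     0 < eta A \<and> eta A < 1 \<and>
     1 < lambda_bar A \<and>
     0 \<le> eps_tol A"

text \<open>The point \<open>w\<^sup>k\<close>, computed from \<open>x' = x\<^sup>k\<^sup>-\<^sup>1\<close> and \<open>x = x\<^sup>k\<close>.\<close>

definition extrapolate ::
    "('w, 't::{finite,linorder}, 'n::finite) model \<Rightarrow> ('t, 'n) params \<Rightarrow>
     ('t, 'n) plan \<Rightarrow> ('t, 'n) plan \<Rightarrow> ('t, 'n) plan" where
  "extrapolate P A x' x =
     (let v = closest_point feasible (x + theta A *\<^sub>R (x - x'))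
      in if Phi P (rho A) v > Phi P (rho A) x then x else v)"

text \<open>
  The vectors the algorithm may choose as \<open>g\<^bsub>\<alpha>,t\<^esub>(z)\<close>, with \<open>q j\<close> the weight of scenario \<open>j\<close>.
  The choice is not unique when several losses tie with the minimizer \<open>u\<close>.
\<close>

definition cvar_subgrad :: "('w, 't, 'n::finite) model \<Rightarrow> 't \<Rightarrow> real ^ 'n \<Rightarrow> real ^ 'n \<Rightarrow> bool" where
  "cvar_subgrad P t z g \<longleftrightarrow>
     (\<exists>u q. is_arg_min (cvar_fun P (alpha P) t z) (\<lambda>_. True) u \<and>
        (\<forall>j\<in>{1..nscen P t}.
           (loss P t j z > u \<longrightarrow> q j = 1) \<and>
           (loss P t j z = u \<longrightarrow> 0 \<le> q j \<and> q j \<le> 1) \<and>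
           (loss P t j z < u \<longrightarrow> q j = 0)) \<and>
        (\<Sum>j = 1..nscen P t. pr P t j * q j) = 1 - alpha P \<and>
        g = - (1 / (1 - alpha P)) *\<^sub>R (\<Sum>j = 1..nscen P t. (pr P t j * q j) *\<^sub>R scen P t j))"

definition linearization ::
    "('w, 't::{finite,linorder}, 'n::finite) model \<Rightarrow> ('t, 'n) params \<Rightarrow>
     ('t, 'n) plan \<Rightarrow> ('t, 'n) plan \<Rightarrow> bool" where
  "linearization P A w u \<longleftrightarrow>
     (\<exists>g. (\<forall>t. cvar_subgrad P t (w $ t) (g $ t)) \<and>
          u = (rho A * B_gam P) *\<^sub>R g + nu A *\<^sub>R w)"

definition subproblem_solution ::
    "('w, 't::{finite,linorder}, 'n::finite) model \<Rightarrow> ('t, 'n) params \<Rightarrow>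
     ('t, 'n) plan \<Rightarrow> ('t, 'n) plan \<Rightarrow> bool" where
  "subproblem_solution P A u y \<longleftrightarrow>
     is_arg_min (\<lambda>x. G_hat P (rho A) (nu A) x - u \<bullet> x) (\<lambda>x. x \<in> feasible) y"

definition stops ::
    "('t::finite, 'n::finite) params \<Rightarrow> ('t, 'n) plan \<Rightarrow> ('t, 'n) plan \<Rightarrow> bool" where
  "stops A w d \<longleftrightarrow>
     norm d = 0 \<or> (0 < eps_tol A \<and> norm d \<le> eps_tol A * max 1 (norm w))"

definition is_max_step ::
    "('t::finite, 'n::finite) plan \<Rightarrow> ('t, 'n) plan \<Rightarrow> real \<Rightarrow> bool" where
  "is_max_step w d l \<longleftrightarrow>
     l \<in> {s. 1 \<le> s \<and> w + s *\<^sub>R d \<in> feasible} \<and>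
     (\<forall>s\<in>{s. 1 \<le> s \<and> w + s *\<^sub>R d \<in> feasible}. s \<le> l)"

text \<open>
  The backtracking loop, where \<open>l\<close> stands for \<open>\<lambda>\<^sub>k\<^sup>m\<^sup>a\<^sup>x\<close>. The result is \<open>None\<close> if and only if the loop
  does not terminate.
\<close>

definition line_search ::
    "('w, 't::{finite,linorder}, 'n::finite) model \<Rightarrow> ('t, 'n) params \<Rightarrow>
     ('t, 'n) plan \<Rightarrow> ('t, 'n) plan \<Rightarrow> real \<Rightarrow> real option" where
  "line_search P A w y l =
     (let d = y - w in
      while_option
        (\<lambda>s. 1 < s \<and>
           Phi P (rho A) (w + s *\<^sub>R d) >
           min (Phi P (rho A) y) (Phi P (rho A) w - sigma A * s\<^sup>2 * (norm d)\<^sup>2))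
        (\<lambda>s. max 1 (eta A * s))
        (min (lambda_bar A) l))"

text \<open>
  \<open>iterates P A k x' x\<close>: some run of the algorithm starts iteration \<open>k\<close> with \<open>x' = x\<^sup>k\<^sup>-\<^sup>1\<close> and
  \<open>x = x\<^sup>k\<close>, that is, it has not terminated in iterations \<open>0, \<dots>, k - 1\<close>.
\<close>

inductive iterates ::
    "('w, 't::{finite,linorder}, 'n::finite) model \<Rightarrow> ('t, 'n) params \<Rightarrow>
     nat \<Rightarrow> ('t, 'n) plan \<Rightarrow> ('t, 'n) plan \<Rightarrow> bool"
  for P A where
  init: "iterates P A 0 (x_init A) (x_init A)"
| step: "\<lbrakk>iterates P A k x' x;
          w = extrapolate P A x' x;
          linearization P A w u;
          subproblem_solution P A u y;
          \<not> stops A w (y - w);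
          is_max_step w (y - w) l;
          line_search P A w y l = Some s\<rbrakk>
         \<Longrightarrow> iterates P A (Suc k) x (w + s *\<^sub>R (y - w))"

end

theory Submission
  imports Defs
begin

text \<open>
  A quantile \<open>v\<close> of the losses at level \<open>\<alpha>\<close> satisfies \<open>\<P>(L < v) \<le> \<beta> \<le> \<P>(L \<le> v)\<close> both for
  \<open>\<beta> = \<alpha>\<close> and, because \<open>\<gamma>\<close> is smaller than the probability gap, for \<open>\<beta> = \<alpha> - \<gamma>\<close>. So \<open>v\<close> minimizes
  both CVaR functions, and subtracting their values gives the DC decomposition of the value at risk.
  CVaR is a maximum of linear functions of the portfolio, one for each admissible weighting of the
  scenarios. This gives its convexity and the subgradient inequality. Descent is then the sum of the
  quadratic growth of the subproblem around its minimizer (modulus \<open>\<lambda>\<^sub>2 + \<nu> / 2\<close>) and the strong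
  convexity of the subtracted part (modulus \<open>\<nu> / 2\<close>); the line search only needs that the feasible
  set is compact and convex.
\<close>

section \<open>Convex functions\<close>

lemma convex_on_sum_fun:
  fixes f :: "'i \<Rightarrow> 'a::real_vector \<Rightarrow> real"
  assumes "convex S" "\<And>i. i \<in> I \<Longrightarrow> convex_on S (f i)"
  shows "convex_on S (\<lambda>x. \<Sum>i\<in>I. f i x)"
  using assms
  by (induction I rule: infinite_finite_induct) (auto simp: convex_on_const intro!: convex_on_add)

lemma convex_on_max:
  assumes "convex_on S f" "convex_on S g"
  shows "convex_on S (\<lambda>x. max (f x) (g x))"
proof (rule convex_onI)
  fix t :: real and x y
  assume t: "0 < t" "t < 1" and xy: "x \<in> S" "y \<in> S"
  have "(1 - t) * f x + t * f y \<le> (1 - t) * max (f x) (g x) + t * max (f y) (g y)"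
    "(1 - t) * g x + t * g y \<le> (1 - t) * max (f x) (g x) + t * max (f y) (g y)"
    using t by (auto intro!: add_mono mult_left_mono)
  then show "max (f ((1 - t) *\<^sub>R x + t *\<^sub>R y)) (g ((1 - t) *\<^sub>R x + t *\<^sub>R y))
      \<le> (1 - t) * max (f x) (g x) + t * max (f y) (g y)"
    using convex_onD[OF assms(1), of t x y] convex_onD[OF assms(2), of t x y] t xy by auto
qed (use assms convex_on_imp_convex in auto)

lemma convex_on_compose_linear:
  assumes "linear g" "convex_on UNIV f"
  shows "convex_on UNIV (\<lambda>x. f (g x))"
  using assms by (auto simp: convex_on_def linear_add linear_scale)

lemma convex_on_linear:
  fixes g :: "'a::real_vector \<Rightarrow> real"
  assumes "linear g"
  shows "convex_on UNIV g"
  using assms by (auto simp: convex_on_def linear_add linear_scale)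

lemma convex_on_abs: "convex_on UNIV (abs :: real \<Rightarrow> real)"
  using convex_on_dist[of UNIV "0::real"] by (simp add: dist_real_def)

lemma norm_sq_convex_combination:
  fixes x y :: "'a::real_inner"
  shows "(norm ((1 - t) *\<^sub>R x + t *\<^sub>R y))\<^sup>2
    = (1 - t) * (norm x)\<^sup>2 + t * (norm y)\<^sup>2 - t * (1 - t) * (norm (y - x))\<^sup>2"
  unfolding power2_norm_eq_inner
  by (simp add: inner_add_left inner_add_right inner_diff_left inner_diff_right inner_commute
      algebra_simps power2_eq_square)

text \<open>Minimality of \<open>y\<close> is tested at points of the segment from \<open>y\<close>
  to \<open>w\<close>. Convexity of \<open>h\<close> and \<open>norm_sq_convex_combination\<close>
  leave a factor \<open>t\<close> that divides out, and the bound follows as the point approaches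
  \<open>y\<close>.\<close>

lemma quadratic_growth_at_minimizer:
  fixes h :: "'a::real_inner \<Rightarrow> real"
  assumes h: "convex_on C h"
    and y: "y \<in> C" "\<And>x. x \<in> C \<Longrightarrow> h y + c * (norm y)\<^sup>2 \<le> h x + c * (norm x)\<^sup>2"
    and w: "w \<in> C"
  shows "h y + c * (norm y)\<^sup>2 + c * (norm (w - y))\<^sup>2 \<le> h w + c * (norm w)\<^sup>2"
proof -
  define q where "q x = h x + c * (norm x)\<^sup>2" for x
  \<comment> \<open>Here \<open>r\<close> is \<open>1 - t\<close>; the passage of \<open>r\<close>
    to 1 is left to \<open>field_le_mult_one_interval\<close>.\<close>
  have "r * (c * (norm (w - y))\<^sup>2) \<le> q w - q y" if r: "0 < r" "r < 1" for r
  proof -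
    define t where "t = 1 - r"
    have t: "0 < t" "t < 1" using r by (auto simp: t_def)
    define z where "z = (1 - t) *\<^sub>R y + t *\<^sub>R w"
    have "z \<in> C"
      using convex_on_imp_convex[OF h] y(1) w t unfolding z_def by (intro convexD) auto
    then have "q y \<le> q z" using y(2) by (simp add: q_def)
    also have "q z \<le> (1 - t) * h y + t * h w + c * (norm z)\<^sup>2"
      using convex_onD[OF h, of t y w] t y w by (simp add: q_def z_def)
    also have "\<dots> = q y + t * (q w - q y - (1 - t) * (c * (norm (w - y))\<^sup>2))"
      unfolding z_def norm_sq_convex_combination q_def by (simp add: algebra_simps)
    finally have "0 \<le> t * (q w - q y - (1 - t) * (c * (norm (w - y))\<^sup>2))" by simp
    then show ?thesis using t by (simp add: zero_le_mult_iff t_def)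
  qed
  then have "c * (norm (w - y))\<^sup>2 \<le> q w - q y" by (rule field_le_mult_one_interval)
  then show ?thesis by (simp add: q_def)
qed


section \<open>Quantiles and value at risk\<close>

text \<open>The least loss value whose cumulative mass reaches \<open>b\<close> serves as
  \<open>v\<close>; it exists because there are finitely many indices.\<close>

lemma quantile_exists:
  fixes L p :: "'i \<Rightarrow> real"
  assumes fin: "finite I" and p: "\<And>i. i \<in> I \<Longrightarrow> 0 \<le> p i"
    and b: "0 < b" "b \<le> sum p I"
  obtains v where "\<And>u. b \<le> sum p {i\<in>I. L i \<le> u} \<longleftrightarrow> v \<le> u"
    and "sum p {i\<in>I. L i < v} < b"
proof -
  define K where "K = L ` {k\<in>I. b \<le> sum p {i\<in>I. L i \<le> L k}}"
  \<comment> \<open>All of \<open>J\<close> lies at or below its largest loss, so that loss is in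
    \<open>K\<close>. Taking for \<open>J\<close> the whole of \<open>I\<close>, then the indices
    with \<open>L i \<le> u\<close>, then those with \<open>L i < v\<close>, yields in turn that
    \<open>K\<close> is nonempty, the forward implication and the strict bound.\<close>
  have key: "\<exists>k\<in>J. L k \<in> K" if J: "J \<subseteq> I" "b \<le> sum p J" for J
  proof -
    have "J \<noteq> {}" "finite J" using J b fin finite_subset by auto
    then have "Max (L ` J) \<in> L ` J" by (intro Max_in) auto
    then obtain k where k: "k \<in> J" "L k = Max (L ` J)" by auto
    have "sum p J \<le> sum p {i\<in>I. L i \<le> L k}"
      using J fin p k \<open>finite J\<close> by (intro sum_mono2) auto
    then have "b \<le> sum p {i\<in>I. L i \<le> L k}" using J k by simp
    then show ?thesis using J k unfolding K_def by blast
  qed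
  have K: "finite K" "K \<noteq> {}"
    using fin key[of I] b by (auto simp: K_def)
  define v where "v = Min K"
  have "v \<in> K" using K by (simp add: v_def)
  then have v: "b \<le> sum p {i\<in>I. L i \<le> v}" by (auto simp: K_def)
  have "b \<le> sum p {i\<in>I. L i \<le> u} \<longleftrightarrow> v \<le> u" for u
  proof
    assume "b \<le> sum p {i\<in>I. L i \<le> u}"
    then obtain k where "L k \<le> u" "L k \<in> K" using key[of "{i\<in>I. L i \<le> u}"] by auto
    then show "v \<le> u" using K Min_le unfolding v_def by fastforce
  next
    assume "v \<le> u"
    then have "sum p {i\<in>I. L i \<le> v} \<le> sum p {i\<in>I. L i \<le> u}"
      using fin p by (intro sum_mono2) auto
    with v show "b \<le> sum p {i\<in>I. L i \<le> u}" by simp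
  qed
  moreover have "sum p {i\<in>I. L i < v} < b"
  proof (rule ccontr)
    assume "\<not> ?thesis"
    then obtain k where "L k < v" "L k \<in> K" using key[of "{i\<in>I. L i < v}"] by auto
    then show False using K Min_le unfolding v_def by fastforce
  qed
  ultimately show ?thesis using that by blast
qed

lemma valid_modelD:
  assumes "valid_model P"
  shows "prob_space (pspace P)" "xi P t \<in> borel_measurable (pspace P)"
    and "j \<in> {1..nscen P t} \<Longrightarrow> 0 \<le> pr P t j"
    and "(\<Sum>j = 1..nscen P t. pr P t j) = 1"
    and "j \<in> {1..nscen P t} \<Longrightarrow>
        measure (pspace P) {\<omega> \<in> space (pspace P). xi P t \<omega> = scen P t j} =
        (\<Sum>i | i \<in> {1..nscen P t} \<and> scen P t i = scen P t j. pr P t i)"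
    and "0 < alpha P" "alpha P < 1" "0 < lambda1 P" "0 < lambda2 P" "0 \<le> cost P i"
    and "0 < gam P" "gam P < eps_bar P t"
  using assms unfolding valid_model_def by (auto simp: less_imp_le)

text \<open>The model fixes only the point masses at the scenario values. They add up to 1, so
  \<open>xi P t\<close> lies almost surely in the finite set of these values, and any Borel set may
  be intersected with it.\<close>

lemma measure_xi_in:
  fixes P :: "('w, 't::{finite,linorder}, 'n::finite) model"
  assumes P: "valid_model P" and C: "C \<in> sets borel"
  shows "measure (pspace P) {\<omega> \<in> space (pspace P). xi P t \<omega> \<in> C}
    = (\<Sum>j | j \<in> {1..nscen P t} \<and> scen P t j \<in> C. pr P t j)"
proof -
  interpret prob_space "pspace P" by (rule valid_modelD[OF P])
  have [measurable]: "xi P t \<in> borel_measurable (pspace P)" by (rule valid_modelD[OF P])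
  note [measurable] = C
  let ?I = "{1..nscen P t}"
  let ?E = "\<lambda>D. {\<omega> \<in> space (pspace P). xi P t \<omega> \<in> D}"
  define V where "V = scen P t ` ?I"
  have finV: "finite V" by (simp add: V_def)
  have fin_case: "prob (?E D) = (\<Sum>j | j \<in> ?I \<and> scen P t j \<in> D. pr P t j)" if D: "D \<subseteq> V" for D
  proof -
    have finD: "finite D" using D finV finite_subset by blast
    have "prob (?E D) = prob (\<Union>z\<in>D. {\<omega> \<in> space (pspace P). xi P t \<omega> = z})"
      by (rule arg_cong[of _ _ prob]) auto
    also have "\<dots> = (\<Sum>z\<in>D. prob {\<omega> \<in> space (pspace P). xi P t \<omega> = z})"
      by (rule finite_measure_finite_Union[OF finD]) (auto simp: disjoint_family_on_def)
    \<comment> \<open>Several indices can share one value: the outer sum runs over the distinct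
      values, and \<open>sum.group\<close> merges the fibres afterwards.\<close>
    also have "\<dots> = (\<Sum>z\<in>D. \<Sum>i | i \<in> {i\<in>?I. scen P t i \<in> D} \<and> scen P t i = z. pr P t i)"
    proof (rule sum.cong[OF refl])
      fix z assume "z \<in> D"
      then obtain j where j: "j \<in> ?I" "z = scen P t j" using D by (auto simp: V_def)
      show "prob {\<omega> \<in> space (pspace P). xi P t \<omega> = z}
          = (\<Sum>i | i \<in> {i\<in>?I. scen P t i \<in> D} \<and> scen P t i = z. pr P t i)"
        unfolding j(2) valid_modelD(5)[OF P j(1)]
        using \<open>z \<in> D\<close> j by (intro sum.cong) auto
    qed
    also have "\<dots> = (\<Sum>j | j \<in> ?I \<and> scen P t j \<in> D. pr P t j)"
      by (rule sum.group) (use finD in auto)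
    finally show ?thesis .
  qed
  have "prob (?E V) = (\<Sum>j\<in>?I. pr P t j)"
    unfolding fin_case[OF order_refl] by (rule sum.cong) (auto simp: V_def)
  then have "prob (?E V) = 1" using valid_modelD(4)[OF P] by simp
  then have ae: "AE \<omega> in pspace P. xi P t \<omega> \<in> V"
    by (auto dest!: AE_prob_1)
  have [measurable]: "V \<in> sets borel"
    using finV by (intro borel_closed finite_imp_closed)
  have "prob (?E C) = prob (?E (C \<inter> V))"
    by (rule finite_measure_eq_AE) (use ae in auto)
  also have "\<dots> = (\<Sum>j | j \<in> ?I \<and> scen P t j \<in> C. pr P t j)"
    unfolding fin_case[OF Int_lower2] by (rule sum.cong) (auto simp: V_def)
  finally show ?thesis .
qed

lemma VaR_quantile:
  fixes P :: "('w, 't::{finite,linorder}, 'n::finite) model"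
  assumes P: "valid_model P"
    and v: "\<And>u. alpha P \<le> sum (pr P t) {j\<in>{1..nscen P t}. loss P t j z \<le> u} \<longleftrightarrow> v \<le> u"
  shows "VaR (pspace P) (alpha P) (\<lambda>\<omega>. - (xi P t \<omega> \<bullet> z)) = v"
proof -
  have "measure (pspace P) {\<omega> \<in> space (pspace P). - (xi P t \<omega> \<bullet> z) \<le> u}
      = sum (pr P t) {j\<in>{1..nscen P t}. loss P t j z \<le> u}" for u
  proof -
    have "{s. - (s \<bullet> z) \<le> u} \<in> sets borel"
      by measurable
    from measure_xi_in[OF P this, of t] show ?thesis by (simp add: loss_def)
  qed
  then have "{u. alpha P \<le> measure (pspace P) {\<omega> \<in> space (pspace P). - (xi P t \<omega> \<bullet> z) \<le> u}} = {v..}"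
    using v by auto
  then show ?thesis by (simp add: VaR_def)
qed


section \<open>Conditional value at risk\<close>

text \<open>The scenario weights of \<open>cvar_subgrad\<close>, at an arbitrary level. In a valid
  model with \<open>\<beta> < 1\<close> they certify that \<open>u\<close> minimizes
  \<open>cvar_fun P \<beta> t z\<close>: they are a dual feasible point complementary to
  \<open>u\<close>.\<close>

definition cvar_weights ::
    "('w, 't, 'n::finite) model \<Rightarrow> real \<Rightarrow> 't \<Rightarrow> real ^ 'n \<Rightarrow> real \<Rightarrow> (nat \<Rightarrow> real) \<Rightarrow> bool" where
  "cvar_weights P \<beta> t z u q \<longleftrightarrow>
     (\<forall>j\<in>{1..nscen P t}.
        (loss P t j z > u \<longrightarrow> q j = 1) \<and>
        (loss P t j z = u \<longrightarrow> 0 \<le> q j \<and> q j \<le> 1) \<and>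
        (loss P t j z < u \<longrightarrow> q j = 0)) \<and>
     (\<Sum>j = 1..nscen P t. pr P t j * q j) = 1 - \<beta>"

text \<open>The gradient of the weighted mean loss as a linear function of the portfolio; the minus
  sign is the one in \<open>loss\<close>.\<close>

definition weighted_loss_grad ::
    "('w, 't, 'n::finite) model \<Rightarrow> real \<Rightarrow> 't \<Rightarrow> (nat \<Rightarrow> real) \<Rightarrow> real ^ 'n" where
  "weighted_loss_grad P \<beta> t q =
     - (1 / (1 - \<beta>)) *\<^sub>R (\<Sum>j = 1..nscen P t. (pr P t j * q j) *\<^sub>R scen P t j)"

text \<open>The weights have total mass \<open>1 - \<beta>\<close>, so the terms in \<open>u\<close>
  cancel and \<open>u\<close> can be chosen freely. In this form the value compares with
  \<open>cvar_fun\<close> term by term.\<close>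

lemma weighted_loss_grad_inner:
  fixes P :: "('w, 't, 'n::finite) model"
  assumes "\<beta> < 1" "(\<Sum>j = 1..nscen P t. pr P t j * q j) = 1 - \<beta>"
  shows "weighted_loss_grad P \<beta> t q \<bullet> z
    = u + 1 / (1 - \<beta>) * (\<Sum>j = 1..nscen P t. pr P t j * (q j * (loss P t j z - u)))"
proof -
  have "(\<Sum>j = 1..nscen P t. pr P t j * (q j * (loss P t j z - u)))
      = (\<Sum>j = 1..nscen P t. pr P t j * q j * loss P t j z - pr P t j * q j * u)"
    by (simp add: algebra_simps)
  also have "\<dots> = (\<Sum>j = 1..nscen P t. pr P t j * q j * loss P t j z)
      - (\<Sum>j = 1..nscen P t. pr P t j * q j) * u"
    by (simp add: sum_subtractf sum_distrib_right)
  also have "(\<Sum>j = 1..nscen P t. pr P t j * q j * loss P t j z)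
      = (1 - \<beta>) * (weighted_loss_grad P \<beta> t q \<bullet> z)"
    using assms(1)
    by (simp add: weighted_loss_grad_def inner_sum_left loss_def sum_negf)
  finally show ?thesis using assms(1) unfolding assms(2) by (simp add: field_simps)
qed

text \<open>Weak duality: a weight in the unit interval satisfies
  \<open>q j * a \<le> max a 0\<close> for every real \<open>a\<close>. The pair \<open>z\<close>,
  \<open>u\<close> enters only through the range and the total mass of the weights, so the bound
  reaches every \<open>z'\<close> and \<open>u'\<close>.\<close>

lemma weighted_loss_le_cvar_fun:
  fixes P :: "('w, 't::{finite,linorder}, 'n::finite) model"
  assumes P: "valid_model P" and "\<beta> < 1" and q: "cvar_weights P \<beta> t z u q"
  shows "weighted_loss_grad P \<beta> t q \<bullet> z' \<le> cvar_fun P \<beta> t z' u'"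
proof -
  have "pr P t j * (q j * (loss P t j z' - u')) \<le> pr P t j * max (loss P t j z' - u') 0"
    if j: "j \<in> {1..nscen P t}" for j
  proof (rule mult_left_mono)
    have "0 \<le> q j" "q j \<le> 1" using q j unfolding cvar_weights_def
      by (cases "loss P t j z" u rule: linorder_cases; force)+
    then have "q j * (loss P t j z' - u') \<le> q j * max (loss P t j z' - u') 0"
      "q j * max (loss P t j z' - u') 0 \<le> max (loss P t j z' - u') 0"
      by (auto intro: mult_left_mono mult_left_le_one_le)
    then show "q j * (loss P t j z' - u') \<le> max (loss P t j z' - u') 0" by (rule order_trans)
  qed (use valid_modelD(3)[OF P j] in simp)
  then have "(\<Sum>j = 1..nscen P t. pr P t j * (q j * (loss P t j z' - u')))
      \<le> (\<Sum>j = 1..nscen P t. pr P t j * max (loss P t j z' - u') 0)"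
    by (rule sum_mono)
  then show ?thesis
    using q \<open>\<beta> < 1\<close> weighted_loss_grad_inner[of \<beta> P t q z' u']
    by (simp add: cvar_weights_def cvar_fun_def divide_right_mono)
qed

text \<open>At \<open>z\<close> and \<open>u\<close> themselves weak duality is tight: the weights 1
  and 0 pick out the positive part, and a tie contributes 0.\<close>

lemma cvar_fun_eq_weighted_loss:
  fixes P :: "('w, 't::{finite,linorder}, 'n::finite) model"
  assumes "\<beta> < 1" and q: "cvar_weights P \<beta> t z u q"
  shows "cvar_fun P \<beta> t z u = weighted_loss_grad P \<beta> t q \<bullet> z"
proof -
  have "max (loss P t j z - u) 0 = q j * (loss P t j z - u)" if "j \<in> {1..nscen P t}" for j
    using q that unfolding cvar_weights_def
    by (cases "loss P t j z" u rule: linorder_cases) auto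
  then show ?thesis
    using weighted_loss_grad_inner[of \<beta> P t q z u] q \<open>\<beta> < 1\<close>
    by (simp add: cvar_fun_def cvar_weights_def)
qed

lemma psi_ge_weighted_loss:
  fixes P :: "('w, 't::{finite,linorder}, 'n::finite) model"
  assumes "valid_model P" "\<beta> < 1" "cvar_weights P \<beta> t z u q"
  shows "weighted_loss_grad P \<beta> t q \<bullet> z' \<le> psi P \<beta> t z'"
  unfolding psi_def using weighted_loss_le_cvar_fun[OF assms] by (intro cINF_greatest) auto

lemma psi_eq_cvar_fun:
  fixes P :: "('w, 't::{finite,linorder}, 'n::finite) model"
  assumes "valid_model P" "\<beta> < 1" "cvar_weights P \<beta> t z u q"
  shows "psi P \<beta> t z = cvar_fun P \<beta> t z u"
  unfolding psi_def
proof (rule cInf_eq_minimum)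
  show "cvar_fun P \<beta> t z u \<in> range (cvar_fun P \<beta> t z)" by simp
  show "cvar_fun P \<beta> t z u \<le> c" if "c \<in> range (cvar_fun P \<beta> t z)" for c
    using that weighted_loss_le_cvar_fun[OF assms] cvar_fun_eq_weighted_loss[OF assms(2,3)] by auto
qed

lemma psi_eq_weighted_loss:
  fixes P :: "('w, 't::{finite,linorder}, 'n::finite) model"
  assumes "valid_model P" "\<beta> < 1" "cvar_weights P \<beta> t z u q"
  shows "psi P \<beta> t z = weighted_loss_grad P \<beta> t q \<bullet> z"
  using psi_eq_cvar_fun[OF assms] cvar_fun_eq_weighted_loss[OF assms(2,3)] by simp

text \<open>Losses above \<open>v\<close> get weight 1 and those below get 0; the atom at
  \<open>v\<close> supplies the missing mass in one common proportion \<open>r\<close>. The two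
  hypotheses say that the missing mass lies between 0 and the mass of the atom.\<close>

lemma cvar_weights_exist:
  fixes P :: "('w, 't::{finite,linorder}, 'n::finite) model"
  assumes P: "valid_model P"
    and lower: "sum (pr P t) {j\<in>{1..nscen P t}. loss P t j z < v} \<le> \<beta>"
    and upper: "\<beta> \<le> sum (pr P t) {j\<in>{1..nscen P t}. loss P t j z \<le> v}"
  obtains q where "cvar_weights P \<beta> t z v q"
proof -
  let ?I = "{1..nscen P t}" and ?L = "\<lambda>j. loss P t j z"
  define a where "a = sum (pr P t) {j\<in>?I. ?L j < v}"
  define b where "b = sum (pr P t) {j\<in>?I. ?L j = v}"
  define c where "c = sum (pr P t) {j\<in>?I. v < ?L j}"
  have le: "sum (pr P t) {j\<in>?I. ?L j \<le> v} = a + b"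
    unfolding a_def b_def by (subst sum.union_disjoint[symmetric]) (auto intro!: sum.cong)
  have "sum (pr P t) {j\<in>?I. ?L j \<le> v} + c = sum (pr P t) ?I"
    unfolding c_def by (subst sum.union_disjoint[symmetric]) (auto intro!: sum.cong)
  then have total: "a + b + c = 1"
    using valid_modelD(4)[OF P] le by simp
  have b: "0 \<le> b"
    unfolding b_def using valid_modelD(3)[OF P] by (intro sum_nonneg) auto
  have bounds: "a \<le> \<beta>" "\<beta> \<le> a + b" using lower upper le by (auto simp: a_def)
  \<comment> \<open>If the atom at \<open>v\<close> has mass \<open>b = 0\<close>, then \<open>a + b - \<beta> = 0\<close> and the junk value \<open>r = 0\<close> is right.\<close>
  define r where "r = (a + b - \<beta>) / b"
  have r: "0 \<le> r" "r \<le> 1" "r * b = a + b - \<beta>"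
    using b bounds unfolding r_def by (auto simp: divide_simps)
  define q where "q j = (if v < ?L j then 1 else if ?L j = v then r else 0)" for j
  have "(\<Sum>j\<in>?I. pr P t j * q j)
      = (\<Sum>j\<in>?I. (if v < ?L j then pr P t j else 0) + r * (if ?L j = v then pr P t j else 0))"
    by (intro sum.cong) (auto simp: q_def)
  also have "\<dots> = c + r * b"
    unfolding c_def b_def sum.inter_filter[OF finite_atLeastAtMost] sum.distrib sum_distrib_left ..
  also have "\<dots> = 1 - \<beta>" using r total by simp
  finally have "cvar_weights P \<beta> t z v q" using r by (auto simp: cvar_weights_def q_def)
  then show ?thesis by (rule that)
qed

text \<open>A quantile of the losses at \<open>z\<close> carries admissible weights, and their
  gradient is the supporting functional.\<close>

lemma psi_support:
  fixes P :: "('w, 't::{finite,linorder}, 'n::finite) model"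
  assumes P: "valid_model P" and b: "0 < \<beta>" "\<beta> < 1"
  obtains g where "psi P \<beta> t z = g \<bullet> z" "\<And>z'. g \<bullet> z' \<le> psi P \<beta> t z'"
proof -
  have "\<beta> \<le> sum (pr P t) {1..nscen P t}" using b valid_modelD(4)[OF P] by simp
  then obtain v where
    v: "\<And>u. \<beta> \<le> sum (pr P t) {j\<in>{1..nscen P t}. loss P t j z \<le> u} \<longleftrightarrow> v \<le> u"
      "sum (pr P t) {j\<in>{1..nscen P t}. loss P t j z < v} < \<beta>"
    using quantile_exists[of "{1..nscen P t}" "pr P t" \<beta> "\<lambda>j. loss P t j z"]
      valid_modelD(3)[OF P] b by auto
  obtain q where "cvar_weights P \<beta> t z v q"
    using cvar_weights_exist[OF P, of t z v \<beta>] v by auto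
  then show ?thesis
    using that psi_eq_weighted_loss[OF P b(2)] psi_ge_weighted_loss[OF P b(2)] by metis
qed

text \<open>A functional supporting \<open>psi\<close> at the intermediate point is linear and lies
  below \<open>psi\<close> at both endpoints.\<close>

lemma convex_on_psi:
  fixes P :: "('w, 't::{finite,linorder}, 'n::finite) model"
  assumes P: "valid_model P" and b: "0 < \<beta>" "\<beta> < 1"
  shows "convex_on UNIV (psi P \<beta> t)"
proof (rule convex_onI)
  fix r :: real and x y :: "real ^ 'n"
  assume r: "0 < r" "r < 1"
  obtain g where g: "psi P \<beta> t ((1 - r) *\<^sub>R x + r *\<^sub>R y) = g \<bullet> ((1 - r) *\<^sub>R x + r *\<^sub>R y)"
    "\<And>z'. g \<bullet> z' \<le> psi P \<beta> t z'"
    using psi_support[OF assms] by blast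
  show "psi P \<beta> t ((1 - r) *\<^sub>R x + r *\<^sub>R y) \<le> (1 - r) * psi P \<beta> t x + r * psi P \<beta> t y"
    unfolding g(1) using g(2)[of x] g(2)[of y] r
    by (auto simp: inner_add_right intro!: add_mono mult_left_mono)
qed simp

text \<open>However ties are weighted, \<open>g\<close> comes from admissible weights: its linear
  functional attains \<open>psi\<close> at \<open>z\<close> and stays below it elsewhere.\<close>

lemma cvar_subgrad_inequality:
  fixes P :: "('w, 't::{finite,linorder}, 'n::finite) model"
  assumes P: "valid_model P" and g: "cvar_subgrad P t z g"
  shows "psi P (alpha P) t z + g \<bullet> (z' - z) \<le> psi P (alpha P) t z'"
proof -
  obtain u q where "cvar_weights P (alpha P) t z u q" "g = weighted_loss_grad P (alpha P) t q"
    using g unfolding cvar_subgrad_def cvar_weights_def weighted_loss_grad_def by blast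
  then show ?thesis
    using psi_eq_weighted_loss[OF P valid_modelD(7)[OF P]] psi_ge_weighted_loss[OF P valid_modelD(7)[OF P]]
    by (simp add: inner_diff_right)
qed


section \<open>The DC decomposition\<close>

text \<open>Only finitely many subset masses exist, and \<open>eps_bar P t\<close> is the distance
  from \<open>alpha P\<close> to the largest one below it. A strict inequality thereby improves to a
  definite gap.\<close>

lemma sum_le_alpha_minus_eps_bar:
  fixes P :: "('w, 't::{finite,linorder}, 'n::finite) model"
  assumes "J \<subseteq> {1..nscen P t}" "sum (pr P t) J < alpha P"
  shows "sum (pr P t) J \<le> alpha P - eps_bar P t"
proof -
  have "finite {J. J \<subseteq> {1..nscen P t} \<and> sum (pr P t) J < alpha P}"
    by (rule finite_subset[of _ "Pow {1..nscen P t}"]) auto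
  then have "sum (pr P t) J
      \<le> Max ((\<lambda>J. sum (pr P t) J) ` {J. J \<subseteq> {1..nscen P t} \<and> sum (pr P t) J < alpha P})"
    using assms by (intro Max_ge) auto
  then show ?thesis by (simp add: eps_bar_def)
qed

text \<open>The empty set of scenarios has mass 0, which bounds \<open>eps_bar\<close> by
  \<open>alpha P\<close>; \<open>undefined\<close> is just some period.\<close>

lemma gam_less_alpha:
  fixes P :: "('w, 't::{finite,linorder}, 'n::finite) model"
  assumes P: "valid_model P"
  shows "gam P < alpha P"
  using sum_le_alpha_minus_eps_bar[of "{}" P undefined] valid_modelD(6)[OF P]
    valid_modelD(12)[OF P, of undefined]
  by simp

lemma VaR_eq_psi_diff:
  fixes P :: "('w, 't::{finite,linorder}, 'n::finite) model"
  assumes P: "valid_model P"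
  shows "VaR (pspace P) (alpha P) (\<lambda>\<omega>. - (xi P t \<omega> \<bullet> z))
    = A_gam P * psi P (alpha P - gam P) t z - B_gam P * psi P (alpha P) t z"
proof -
  have a: "0 < alpha P" "alpha P < 1" and gam: "0 < gam P" "gam P < eps_bar P t"
    using valid_modelD[OF P] by auto
  have "alpha P \<le> sum (pr P t) {1..nscen P t}" using a valid_modelD(4)[OF P] by simp
  then obtain v where
    v: "\<And>u. alpha P \<le> sum (pr P t) {j\<in>{1..nscen P t}. loss P t j z \<le> u} \<longleftrightarrow> v \<le> u"
    and lower: "sum (pr P t) {j\<in>{1..nscen P t}. loss P t j z < v} < alpha P"
    using quantile_exists[of "{1..nscen P t}" "pr P t" "alpha P" "\<lambda>j. loss P t j z"]
      valid_modelD(3)[OF P] a by auto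
  have upper: "alpha P \<le> sum (pr P t) {j\<in>{1..nscen P t}. loss P t j z \<le> v}"
    using v by simp
  \<comment> \<open>The choice of \<open>gam P\<close> below the gap keeps the quantile
    \<open>v\<close> admissible at the lower level too.\<close>
  have gap: "sum (pr P t) {j\<in>{1..nscen P t}. loss P t j z < v} \<le> alpha P - gam P"
    using sum_le_alpha_minus_eps_bar[OF _ lower] gam by force
  define S where "S = (\<Sum>j = 1..nscen P t. pr P t j * max (loss P t j z - v) 0)"
  have psi: "(1 - \<beta>) * psi P \<beta> t z = (1 - \<beta>) * v + S"
    if level: "\<beta> \<in> {alpha P - gam P, alpha P}" for \<beta>
  proof -
    have "\<beta> < 1" using level a gam by auto
    obtain q where q: "cvar_weights P \<beta> t z v q"
      by (rule cvar_weights_exist[OF P, of t z v \<beta>]) (use level upper gap gam in auto)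
    then show ?thesis
      using psi_eq_cvar_fun[OF P \<open>\<beta> < 1\<close> q] \<open>\<beta> < 1\<close> by (simp add: cvar_fun_def S_def field_simps)
  qed
  \<comment> \<open>The excess \<open>S\<close> is the same at both levels and cancels in the
    difference, while the coefficients of \<open>v\<close> differ by exactly
    \<open>gam P\<close>.\<close>
  have "gam P * v = (1 - alpha P + gam P) * psi P (alpha P - gam P) t z
      - (1 - alpha P) * psi P (alpha P) t z"
    using psi[of "alpha P"] psi[of "alpha P - gam P"] by (simp add: algebra_simps)
  then have "v = A_gam P * psi P (alpha P - gam P) t z - B_gam P * psi P (alpha P) t z"
    using gam
    by (simp add: A_gam_def B_gam_def eq_divide_eq mult.commute flip: diff_divide_distrib)
  then show ?thesis using VaR_quantile[OF P v] by simp
qed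

text \<open>In each period \<open>max (a - b - \<tau>) 0 = max (a - \<tau>) b - b\<close>, applied
  to the two CVaR terms of the value at risk.\<close>

lemma Phi_eq_G_minus_H:
  fixes P :: "('w, 't::{finite,linorder}, 'n::finite) model"
  assumes P: "valid_model P"
  shows "Phi P \<rho> x = G_fun P \<rho> x - \<rho> * B_gam P * (\<Sum>t\<in>UNIV. psi P (alpha P) t (x $ t))"
proof -
  have "risk P x = (\<Sum>t\<in>UNIV.
      max (A_gam P * psi P (alpha P - gam P) t (x $ t) - tau P) (B_gam P * psi P (alpha P) t (x $ t))
      - B_gam P * psi P (alpha P) t (x $ t))"
    unfolding risk_def VaR_eq_psi_diff[OF P] by (intro sum.cong) auto
  then show ?thesis
    by (simp add: Phi_def G_fun_def sum_subtractf right_diff_distrib flip: sum_distrib_left)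
qed

lemma norm_sq_vec: "(norm x)\<^sup>2 = (\<Sum>i\<in>UNIV. (norm (x $ i))\<^sup>2)"
  for x :: "'a::real_normed_vector ^ 'm"
  by (simp add: norm_vec_def L2_set_def sum_nonneg)

lemma linear_vec_component: "linear (\<lambda>x :: 'a::real_vector ^ 'm. x $ i)"
  by (rule linearI) auto

text \<open>The subtracted square is exactly the quadratic part of \<open>G_hat\<close>; linear
  terms, absolute values and maxima of CVaR terms with nonnegative factors remain. Strong convexity
  in this form serves both quadratic growth and continuity.\<close>

lemma convex_on_G_hat:
  fixes P :: "('w, 't::{finite,linorder}, 'n::finite) model"
  assumes P: "valid_model P" and "0 \<le> \<rho>"
  shows "convex_on UNIV (\<lambda>x. G_hat P \<rho> \<nu> x - (lambda2 P + \<nu> / 2) * (norm x)\<^sup>2)"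
proof -
  note pos = valid_modelD(7-11)[OF P]
  have block: "convex_on UNIV (\<lambda>x :: ('t, 'n) plan. psi P \<beta> t (x $ t))" if "0 < \<beta>" "\<beta> < 1" for \<beta> t
    using convex_on_compose_linear[OF linear_vec_component convex_on_psi[OF P that]] .
  have shift: "convex_on UNIV (\<lambda>x :: ('t, 'n) plan. \<bar>x $ t $ i - c\<bar>)" for t i c
    using convex_on_compose_linear[OF _ convex_on_dist[of UNIV c], of "\<lambda>x :: ('t, 'n) plan. x $ t $ i"]
    by (simp add: dist_real_def abs_minus_commute linearI)
  have trade: "convex_on UNIV (\<lambda>x :: ('t, 'n) plan. \<bar>x $ t $ i - x $ s $ i\<bar>)" for t s i
    by (rule convex_on_compose_linear[OF _ convex_on_abs]) (auto intro!: linearI simp: algebra_simps)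
  have lin: "convex_on UNIV (\<lambda>x :: ('t, 'n) plan. - (\<Sum>t\<in>UNIV. mean P t \<bullet> x $ t))"
    by (rule convex_on_linear)
      (auto intro!: linearI simp: inner_add_right sum.distrib sum_distrib_left)
  have A: "0 \<le> A_gam P" and B: "0 \<le> B_gam P"
    using pos by (auto simp: A_gam_def B_gam_def)
  have levels: "0 < alpha P - gam P" "alpha P - gam P < 1" "0 < alpha P" "alpha P < 1"
    using gam_less_alpha[OF P] pos by auto
  \<comment> \<open>The threshold is written as the summand \<open>- tau P\<close> so that
    \<open>convex_on_add\<close> matches it.\<close>
  have h: "convex_on UNIV (\<lambda>x :: ('t, 'n) plan.
      (- (\<Sum>t\<in>UNIV. mean P t \<bullet> x $ t)
       + lambda1 P *
         ((\<Sum>i\<in>UNIV. cost P i * \<bar>x $ first_period $ i - w_prev P $ i\<bar>)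
          + (\<Sum>t\<in>UNIV - {first_period}. \<Sum>i\<in>UNIV.
               cost P i * \<bar>x $ t $ i - x $ prev_period t $ i\<bar>)))
      + \<rho> * (\<Sum>t\<in>UNIV.
       max (A_gam P * psi P (alpha P - gam P) t (x $ t) + (- tau P))
           (B_gam P * psi P (alpha P) t (x $ t))))" (is "convex_on _ ?h")
    using pos valid_modelD(10)[OF P] \<open>0 \<le> \<rho>\<close> A B levels
    by (intro convex_on_add convex_on_cmul convex_on_sum_fun convex_on_max lin shift trade block)
      (auto simp: convex_on_const)
  have "?h x = G_hat P \<rho> \<nu> x - (lambda2 P + \<nu> / 2) * (norm x)\<^sup>2" for x
    unfolding G_hat_def G_fun_def obj_def norm_sq_vec[of x, symmetric] distrib_right
    by simp
  then have "?h = (\<lambda>x. G_hat P \<rho> \<nu> x - (lambda2 P + \<nu> / 2) * (norm x)\<^sup>2)" by (rule ext)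
  with h show ?thesis by (rule subst[rotated])
qed


section \<open>The feasible set and the line search\<close>

lemma convex_portfolios: "convex portfolios"
  by (auto simp: convex_def portfolios_def sum.distrib simp flip: sum_distrib_left)

lemma compact_portfolios: "compact (portfolios :: (real ^ 'n::finite) set)"
proof (rule compact_eq_bounded_closed[THEN iffD2, OF conjI])
  have "portfolios = {z :: real ^ 'n. (\<Sum>i\<in>UNIV. z $ i) = 1} \<inter> (\<Inter>i. {z. 0 \<le> z $ i})"
    by (auto simp: portfolios_def)
  also have "closed \<dots>"
    by (intro closed_Int closed_INT closed_Collect_eq closed_Collect_le ballI continuous_intros)
  finally show "closed (portfolios :: (real ^ 'n::finite) set)" .
  have "norm z \<le> 1" if "z \<in> portfolios" for z :: "real ^ 'n"
    using norm_le_l1_cart[of z] that by (simp add: portfolios_def)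
  then show "bounded (portfolios :: (real ^ 'n::finite) set)" by (auto simp: bounded_iff)
qed

lemma portfolios_nonempty: "portfolios \<noteq> ({} :: (real ^ 'n::finite) set)"
proof -
  have "axis undefined 1 \<in> (portfolios :: (real ^ 'n) set)"
    by (auto simp: portfolios_def axis_def)
  then show ?thesis by blast
qed

lemma convex_feasible: "convex feasible"
  using convex_portfolios by (auto simp: convex_def feasible_def)

lemma compact_feasible: "compact (feasible :: ('t::finite, 'n::finite) plan set)"
proof (rule compact_eq_bounded_closed[THEN iffD2, OF conjI])
  have "feasible = (\<Inter>t. {x :: ('t, 'n) plan. x $ t \<in> portfolios})"
    by (auto simp: feasible_def)
  also have "closed \<dots>"
    using compact_imp_closed[OF compact_portfolios]
    by (intro closed_INT ballI closed_vimage[unfolded vimage_def] continuous_intros)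
  finally show "closed (feasible :: ('t, 'n) plan set)" .
  obtain B where "\<And>z. z \<in> portfolios \<Longrightarrow> norm (z :: real ^ 'n) \<le> B"
    using compact_imp_bounded[OF compact_portfolios] by (auto simp: bounded_iff)
  then have "norm x \<le> (\<Sum>t\<in>(UNIV :: 't set). B)" if "x \<in> feasible" for x :: "('t, 'n) plan"
    using that unfolding norm_vec_def[of x] feasible_def
    by (intro order_trans[OF L2_set_le_sum] sum_mono) auto
  then show "bounded (feasible :: ('t, 'n) plan set)" by (auto simp: bounded_iff)
qed

lemma feasible_nonempty: "feasible \<noteq> ({} :: ('t::finite, 'n::finite) plan set)"
proof -
  obtain z :: "real ^ 'n" where "z \<in> portfolios" using portfolios_nonempty by blast
  then have "(\<chi> t. z) \<in> (feasible :: ('t, 'n) plan set)" by (simp add: feasible_def)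
  then show ?thesis by blast
qed

text \<open>The admissible step lengths form a compact set containing 1: closed as a preimage, and
  bounded because the feasible set is bounded and \<open>d \<noteq> 0\<close>.\<close>

lemma max_step_exists:
  assumes "w + d \<in> feasible" "d \<noteq> 0"
  obtains l where "is_max_step w d l"
proof -
  define S where "S = {s. 1 \<le> s \<and> w + s *\<^sub>R d \<in> feasible}"
  have "S = {1..} \<inter> (\<lambda>s. w + s *\<^sub>R d) -` feasible" by (auto simp: S_def)
  also have "closed \<dots>"
    using compact_imp_closed[OF compact_feasible]
    by (intro closed_Int closed_vimage continuous_intros) auto
  finally have "closed S" .
  obtain B where B: "\<And>x. x \<in> feasible \<Longrightarrow> norm (x - w) \<le> B"
    using bounded_translation[OF compact_imp_bounded[OF compact_feasible], of "- w"]
    by (auto simp: bounded_iff)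
  have "norm s \<le> B / norm d" if "s \<in> S" for s
    using B[of "w + s *\<^sub>R d"] that assms(2) by (simp add: S_def pos_le_divide_eq)
  then have "bounded S" by (auto simp: bounded_iff)
  with \<open>closed S\<close> have "compact S" by (simp add: compact_eq_bounded_closed)
  moreover have "1 \<in> S" using assms by (simp add: S_def)
  ultimately obtain l where "l \<in> S" "\<forall>s\<in>S. s \<le> l"
    using compact_attains_sup[of S] by auto
  then have "is_max_step w d l" by (simp add: is_max_step_def S_def)
  then show ?thesis by (rule that)
qed

text \<open>Both bounds form a loop invariant: a reduction does not increase \<open>r\<close> unless
  it resets it to 1, and 1 is at most \<open>lambda_bar A\<close> and \<open>l\<close>.\<close>

lemma line_search_bounds:
  assumes "line_search P A w y l = Some s" "valid_params P A" "1 \<le> l"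
  shows "1 \<le> s" "s \<le> min (lambda_bar A) l"
proof -
  have A: "0 < eta A" "eta A < 1" "1 < lambda_bar A"
    using assms(2) by (auto simp: valid_params_def)
  have step: "1 \<le> max 1 (eta A * r) \<and> max 1 (eta A * r) \<le> min (lambda_bar A) l"
    if "1 \<le> r \<and> r \<le> min (lambda_bar A) l" for r
  proof -
    have "eta A * r \<le> 1 * r" using A that by (intro mult_right_mono) auto
    then show ?thesis using that A assms(3) by linarith
  qed
  show "1 \<le> s" "s \<le> min (lambda_bar A) l"
    using while_option_rule[where P = "\<lambda>r. 1 \<le> r \<and> r \<le> min (lambda_bar A) l",
        OF step assms(1)[unfolded line_search_def Let_def]] A assms(3)
    by auto
qed

lemma line_search_terminates:
  assumes A: "valid_params P A"
  shows "\<exists>s. line_search P A w y l = Some s"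
proof -
  have eta: "0 < eta A" "eta A < 1"
    using A by (auto simp: valid_params_def)
  \<comment> \<open>\<open>Q\<close> stands for the decrease test; termination rests on the guard
    \<open>1 < s\<close>.\<close>
  have loop: "\<exists>s. while_option (\<lambda>s. 1 < s \<and> Q s) (\<lambda>s. max 1 (eta A * s)) s0 = Some s"
    for Q :: "real \<Rightarrow> bool" and s0
  proof -
    \<comment> \<open>Here \<open>n\<close> bounds the number of rounds. One reduction lowers the
      exponent by one, and a reset to 1 keeps the inequality because
      \<open>eta A ^ n \<le> 1\<close>.\<close>
    have *: "s0 * eta A ^ n \<le> 1 \<Longrightarrow>
        \<exists>s. while_option (\<lambda>s. 1 < s \<and> Q s) (\<lambda>s. max 1 (eta A * s)) s0 = Some s" for n s0
    proof (induction n arbitrary: s0)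
      case 0
      then show ?case by (subst while_option_unfold) auto
    next
      case (Suc n)
      have "eta A ^ n \<le> 1" using eta by (simp add: power_le_one)
      then have "max 1 (eta A * s0) * eta A ^ n \<le> 1"
        using Suc.prems by (auto simp: max_def mult_ac)
      from Suc.IH[OF this] show ?case by (subst while_option_unfold) auto
    qed
    have "(\<lambda>n. s0 * eta A ^ n) \<longlonglongrightarrow> s0 * 0"
      using eta by (intro tendsto_mult_left LIMSEQ_realpow_zero) auto
    then have "\<forall>\<^sub>F n in sequentially. s0 * eta A ^ n < 1"
      by (rule order_tendstoD) simp
    then obtain n where "s0 * eta A ^ n < 1"
      by (auto simp: eventually_sequentially)
    then show ?thesis using *[of s0 n] by simp
  qed
  show ?thesis unfolding line_search_def Let_def by (rule loop)
qed

lemma max_step_segment_feasible: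
  assumes "w \<in> feasible" "is_max_step w d l" "0 \<le> s" "s \<le> l"
  shows "w + s *\<^sub>R d \<in> feasible"
proof -
  have l: "1 \<le> l" "w + l *\<^sub>R d \<in> feasible" using assms(2) by (auto simp: is_max_step_def)
  have "(1 - s / l) *\<^sub>R w + (s / l) *\<^sub>R (w + l *\<^sub>R d) \<in> feasible"
    using assms l by (intro convexD[OF convex_feasible]) auto
  also have "(1 - s / l) *\<^sub>R w + (s / l) *\<^sub>R (w + l *\<^sub>R d) = w + s *\<^sub>R d"
    using l by (simp add: algebra_simps)
  finally show ?thesis .
qed

lemma extrapolate_feasible:
  assumes "x \<in> feasible"
  shows "extrapolate P A x' x \<in> feasible"
proof -
  have "closest_point feasible (x + theta A *\<^sub>R (x - x')) \<in> feasible"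
    using compact_imp_closed[OF compact_feasible] feasible_nonempty by (rule closest_point_in_set)
  then show ?thesis using assms by (simp add: extrapolate_def Let_def)
qed

text \<open>Each new iterate lies on the segment from \<open>w\<close> to the farthest feasible
  point in the search direction.\<close>

lemma iterates_feasible:
  assumes "iterates P A k x' x" and A: "valid_params P A"
  shows "x \<in> feasible"
  using assms(1)
proof induction
  case init
  then show ?case using A by (simp add: valid_params_def)
next
  case (step k x' x w u y l s)
  then have "1 \<le> l" "w \<in> feasible" by (auto simp: is_max_step_def extrapolate_feasible)
  with line_search_bounds[OF \<open>line_search P A w y l = Some s\<close> A] step show ?case
    by (intro max_step_segment_feasible) auto
qed


section \<open>The subproblem\<close>

text \<open>Up to a square, \<open>G_hat\<close> is a finite convex function on the whole space,
  hence continuous, and the feasible set is compact and nonempty.\<close>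

lemma subproblem_solution_exists:
  fixes P :: "('w, 't::{finite,linorder}, 'n::finite) model" and A :: "('t, 'n) params"
  assumes P: "valid_model P" and A: "valid_params P A"
  shows "\<exists>y. subproblem_solution P A u y"
proof -
  define h where
    "h x = G_hat P (rho A) (nu A) x - (lambda2 P + nu A / 2) * (norm x)\<^sup>2" for x
  have "convex_on UNIV h"
    unfolding h_def using A by (intro convex_on_G_hat[OF P]) (simp add: valid_params_def)
  then have "continuous_on UNIV h" by (intro convex_on_continuous) auto
  then have "continuous_on feasible h" by (rule continuous_on_subset) simp
  then have "continuous_on feasible (\<lambda>x. h x + (lambda2 P + nu A / 2) * (norm x)\<^sup>2 - u \<bullet> x)"
    by (intro continuous_intros)
  then obtain y where "y \<in> feasible"
    "\<forall>x\<in>feasible. G_hat P (rho A) (nu A) y - u \<bullet> y \<le> G_hat P (rho A) (nu A) x - u \<bullet> x"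
    using continuous_attains_inf[OF compact_feasible feasible_nonempty] by (force simp: h_def)
  then have "subproblem_solution P A u y"
    by (auto simp: subproblem_solution_def is_arg_min_linorder)
  then show ?thesis ..
qed

lemma subproblem_growth:
  fixes P :: "('w, 't::{finite,linorder}, 'n::finite) model" and A :: "('t, 'n) params"
  assumes P: "valid_model P" and A: "valid_params P A"
    and y: "subproblem_solution P A u y" and w: "w \<in> feasible"
  shows "G_hat P (rho A) (nu A) y - u \<bullet> y + (lambda2 P + nu A / 2) * (norm (w - y))\<^sup>2
    \<le> G_hat P (rho A) (nu A) w - u \<bullet> w"
proof -
  \<comment> \<open>The linear term joins the convex part, so the whole square remains available for
    the growth bound.\<close>
  define h where
    "h x = G_hat P (rho A) (nu A) x - (lambda2 P + nu A / 2) * (norm x)\<^sup>2 + - (u \<bullet> x)" for x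
  have "convex_on UNIV h"
    unfolding h_def using A
    by (intro convex_on_add convex_on_G_hat[OF P] convex_on_linear)
      (auto intro!: linearI simp: valid_params_def inner_add_right)
  then have h: "convex_on feasible h"
    using convex_feasible by (rule convex_on_subset[OF _ subset_UNIV])
  have y': "y \<in> feasible"
    "\<And>x. x \<in> feasible \<Longrightarrow> h y + (lambda2 P + nu A / 2) * (norm y)\<^sup>2
        \<le> h x + (lambda2 P + nu A / 2) * (norm x)\<^sup>2"
    using y by (auto simp: subproblem_solution_def is_arg_min_linorder h_def)
  show ?thesis
    using quadratic_growth_at_minimizer[OF h y' w] by (simp add: h_def)
qed

text \<open>Two minimizers have equal values, which forces the growth term between them to
  vanish.\<close>

lemma subproblem_solution_unique:
  fixes P :: "('w, 't::{finite,linorder}, 'n::finite) model" and A :: "('t, 'n) params"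
  assumes P: "valid_model P" and A: "valid_params P A"
    and y: "subproblem_solution P A u y" and z: "subproblem_solution P A u z"
  shows "y = z"
proof -
  have "z \<in> feasible" "G_hat P (rho A) (nu A) z - u \<bullet> z \<le> G_hat P (rho A) (nu A) y - u \<bullet> y"
    using y z by (auto simp: subproblem_solution_def is_arg_min_linorder)
  then have "(lambda2 P + nu A / 2) * (norm (z - y))\<^sup>2 \<le> 0"
    using subproblem_growth[OF P A y] by fastforce
  moreover have "0 < lambda2 P + nu A / 2"
    using valid_modelD(9)[OF P] A by (simp add: valid_params_def)
  ultimately show ?thesis by (simp add: mult_le_0_iff)
qed

lemma Phi_descent:
  fixes P :: "('w, 't::{finite,linorder}, 'n::finite) model" and A :: "('t, 'n) params"
  assumes P: "valid_model P" and A: "valid_params P A" and w: "w \<in> feasible"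
    and u: "linearization P A w u" and y: "subproblem_solution P A u y"
  shows "Phi P (rho A) y \<le> Phi P (rho A) w - (lambda2 P + nu A) * (norm (y - w))\<^sup>2"
proof -
  obtain g where g: "\<And>t. cvar_subgrad P t (w $ t) (g $ t)"
    and u_eq: "u = (rho A * B_gam P) *\<^sub>R g + nu A *\<^sub>R w"
    using u by (auto simp: linearization_def)
  have nonneg: "0 \<le> rho A * B_gam P"
    using A valid_modelD(7,11)[OF P] by (simp add: valid_params_def B_gam_def)
  \<comment> \<open>The subgradient inequalities of the periods add up, since the inner product of
    plans is the sum over blocks.\<close>
  have "(\<Sum>t\<in>UNIV. psi P (alpha P) t (w $ t)) + g \<bullet> (y - w)
      \<le> (\<Sum>t\<in>UNIV. psi P (alpha P) t (y $ t))"
    using sum_mono[of UNIV "\<lambda>t. psi P (alpha P) t (w $ t) + g $ t \<bullet> (y $ t - w $ t)"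
        "\<lambda>t. psi P (alpha P) t (y $ t)"] cvar_subgrad_inequality[OF P g]
    by (simp add: inner_vec_def[of g] sum.distrib)
  from mult_left_mono[OF this nonneg]
  have H: "rho A * B_gam P * (\<Sum>t\<in>UNIV. psi P (alpha P) t (w $ t))
      + rho A * B_gam P * (g \<bullet> (y - w))
      \<le> rho A * B_gam P * (\<Sum>t\<in>UNIV. psi P (alpha P) t (y $ t))"
    by (simp only: distrib_left)
  \<comment> \<open>This expansion around \<open>w\<close> is exact; its remainder supplies the
    second \<open>nu A / 2\<close> in the descent constant.\<close>
  have "nu A / 2 * (norm y)\<^sup>2 = nu A / 2 * (norm w)\<^sup>2 + nu A * (w \<bullet> (y - w))
      + nu A / 2 * (norm (y - w))\<^sup>2"
    unfolding power2_norm_eq_inner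
    by (simp add: inner_diff_left inner_diff_right inner_commute field_simps)
  moreover have "u \<bullet> y - u \<bullet> w = rho A * B_gam P * (g \<bullet> (y - w)) + nu A * (w \<bullet> (y - w))"
    unfolding u_eq by (simp add: inner_add_left inner_diff_right algebra_simps)
  moreover note subproblem_growth[OF P A y w] H
  ultimately show ?thesis
    unfolding Phi_eq_G_minus_H[OF P] G_hat_def norm_minus_commute[of w y]
    by (simp add: algebra_simps)
qed

theorem lemma4p2:
  fixes P :: "('w, 't::{finite,linorder}, 'n::finite) model"
    and A :: "('t, 'n) params"
    and k :: nat
    and x' x w u :: "('t, 'n) plan"
  assumes "valid_model P"
    and "valid_params P A"
    and "iterates P A k x' x"
    and "w = extrapolate P A x' x"
    and "linearization P A w u"
  shows "(\<exists>!y. subproblem_solution P A u y) \<and>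
    (\<forall>y. subproblem_solution P A u y \<longrightarrow>
       Phi P (rho A) y \<le> Phi P (rho A) w - (lambda2 P + nu A) * (norm (y - w))\<^sup>2 \<and>
       (\<not> stops A w (y - w) \<longrightarrow>
          (\<exists>l. is_max_step w (y - w) l \<and> 1 \<le> l \<and>
             (\<exists>s. line_search P A w y l = Some s \<and>
                1 \<le> s \<and> s \<le> min (lambda_bar A) l \<and>
                w + s *\<^sub>R (y - w) \<in> feasible))))"
proof -
  note P = assms(1) and A = assms(2)
  have w: "w \<in> feasible"
    unfolding assms(4) by (rule extrapolate_feasible[OF iterates_feasible[OF assms(3) A]])
  have search: "\<exists>l. is_max_step w (y - w) l \<and> 1 \<le> l \<and>
      (\<exists>s. line_search P A w y l = Some s \<and> 1 \<le> s \<and> s \<le> min (lambda_bar A) l \<and>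
         w + s *\<^sub>R (y - w) \<in> feasible)"
    if y: "subproblem_solution P A u y" and "\<not> stops A w (y - w)" for y
  proof -
    \<comment> \<open>Feasibility of \<open>y\<close> makes step length 1 admissible, and not
      stopping excludes a zero direction.\<close>
    have "w + (y - w) \<in> feasible" "y - w \<noteq> 0"
      using that by (auto simp: subproblem_solution_def is_arg_min_def stops_def)
    then obtain l where l: "is_max_step w (y - w) l" by (rule max_step_exists)
    then have "1 \<le> l" by (simp add: is_max_step_def)
    moreover obtain s where "line_search P A w y l = Some s"
      using line_search_terminates[OF A] by blast
    moreover from line_search_bounds[OF this A \<open>1 \<le> l\<close>]
    have "1 \<le> s" "s \<le> min (lambda_bar A) l" "w + s *\<^sub>R (y - w) \<in> feasible"
      using max_step_segment_feasible[OF w l, of s] by auto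
    ultimately show ?thesis using l by blast
  qed
  have "\<exists>!y. subproblem_solution P A u y"
    using subproblem_solution_exists[OF P A] subproblem_solution_unique[OF P A] by blast
  then show ?thesis
    using Phi_descent[OF P A w assms(5)] search by blast
qed

end
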